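(* Let $m,n$ be positive integers. The polytope $P(m,n)$ consists exactly of all real $m\times n$ matrices $X=(X_{ij})$ such that $0\le\sum_{i'=1}^{i}X_{i'j}\le 1$ for all $1\le i\le m$, $1\le j\le n$, and $0\le \sum_{j'=1}^{j}X_{ij'}$ for all $1\le i\le m$, $1\le j\le n$.
   Context: A sign matrix is a matrix $M=(M_{ij})$ with entries in $\{-1,0,1\}$ such that every column partial sum from the top $\sum_{i'=1}^{i}M_{i'j}$ lies in $\{0,1\}$ and every row partial sum from the left $\sum_{j'=1}^{j}M_{ij'}$ is nonnegative. $P(m,n)$ is the convex hull in $\mathbb{R}^{mn}$ of all $m\times n$ sign matrices. *)

theory Defs
  imports "HOL-Analysis.Analysis"
begin

text \<open>
  An \<open>m \<times> n\<close> real matrix is an element of \<open>real ^ 'n ^ 'm\<close>, with \<open>m = CARD('m)\<close> and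
  \<open>n = CARD('n)\<close>, so that \<open>M $ i $ j\<close> is the entry in row \<open>i\<close> and column \<open>j\<close>. The index types
  are finite linear orders, playing the roles of \<open>{1,...,m}\<close> and \<open>{1,...,n}\<close> with their usual
  order: the first row is the top one, the first column the leftmost one.
\<close>

definition col_partial_sum ::
    "real ^ 'n ^ ('m :: {finite, linorder}) \<Rightarrow> 'm \<Rightarrow> 'n \<Rightarrow> real" where
  "col_partial_sum M i j = (\<Sum>i'\<in>{..i}. M $ i' $ j)"

definition row_partial_sum ::
    "real ^ ('n :: {finite, linorder}) ^ 'm \<Rightarrow> 'm \<Rightarrow> 'n \<Rightarrow> real" where
  "row_partial_sum M i j = (\<Sum>j'\<in>{..j}. M $ i $ j')"

definition sign_matrix ::
    "real ^ ('n :: {finite, linorder}) ^ ('m :: {finite, linorder}) \<Rightarrow> bool" where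
  "sign_matrix M \<longleftrightarrow>
     (\<forall>i j. M $ i $ j \<in> {-1, 0, 1}) \<and>
     (\<forall>i j. col_partial_sum M i j \<in> {0, 1}) \<and>
     (\<forall>i j. 0 \<le> row_partial_sum M i j)"

definition sign_matrix_polytope ::
    "(real ^ ('n :: {finite, linorder}) ^ ('m :: {finite, linorder})) set" where
  "sign_matrix_polytope = convex hull {M. sign_matrix M}"

end

theory Submission
  imports Defs
begin

text \<open>
  In terms of the corner sums \<open>S\<^sub>i\<^sub>j\<close>, the sum of the entries of \<open>X\<close> in the rows up to \<open>i\<close> and the
  columns up to \<open>j\<close>, the inequalities bound differences of two corner sums by integers:
  \<open>0 \<le> S\<^sub>i\<^sub>j - S\<^sub>i\<^sub>,\<^sub>j\<^sub>-\<^sub>1 \<le> 1\<close> and \<open>0 \<le> S\<^sub>i\<^sub>j - S\<^sub>i\<^sub>-\<^sub>1\<^sub>,\<^sub>j\<close>. Such inequalities survive replacing every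
  \<open>S\<^sub>i\<^sub>j\<close> by \<open>\<lfloor>S\<^sub>i\<^sub>j + \<theta>\<rfloor>\<close>, so this rounding gives a sign matrix for each \<open>\<theta>\<close>. Since \<open>\<lfloor>x + \<theta>\<rfloor>\<close> has
  mean \<open>x\<close> over \<open>\<theta> \<in> [0,1]\<close>, the matrix \<open>X\<close> is the mean of sign matrices, and a hyperplane cannot
  separate it from their convex hull.
\<close>

text \<open>As \<open>t\<close> runs over \<open>[0,1]\<close>, the floor jumps once, at
  \<open>1 - frac x\<close>, from \<open>\<lfloor>x\<rfloor>\<close> to
  \<open>\<lfloor>x\<rfloor> + 1\<close>. The upper value holds on a piece of length
  \<open>frac x\<close>, so the integral is \<open>\<lfloor>x\<rfloor> + frac x\<close>.\<close>

lemma has_integral_floor_add: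
  fixes x :: real
  shows "((\<lambda>t. of_int \<lfloor>x + t\<rfloor>) has_integral x) {0..1}"
proof -
  let ?n = "real_of_int \<lfloor>x\<rfloor>" and ?c = "1 - frac x"
  have c: "0 \<le> ?c" "?c \<le> 1" "frac x < 1"
    using frac_lt_1[of x] frac_ge_0[of x] by linarith+
  have "((\<lambda>t. of_int \<lfloor>x + t\<rfloor>) has_integral ?c * ?n) {0..?c}"
  \<comment> \<open>The floor has already jumped at the right endpoint \<open>?c\<close>, so this
    single point is discarded.\<close>
  proof (rule has_integral_spike_finite[of "{?c}" _ _ "\<lambda>t. ?n"])
    show "of_int \<lfloor>x + t\<rfloor> = ?n" if "t \<in> {0..?c} - {?c}" for t
    proof -
      have "\<lfloor>x + t\<rfloor> = \<lfloor>x\<rfloor>"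
        using that by (intro floor_unique) (auto simp: frac_def, linarith)
      then show ?thesis by simp
    qed
    show "((\<lambda>t. ?n) has_integral ?c * ?n) {0..?c}"
      using has_integral_const_real[of ?n 0 ?c] c by simp
  qed simp
  moreover have "((\<lambda>t. of_int \<lfloor>x + t\<rfloor>) has_integral frac x * (?n + 1)) {?c..1}"
  proof (rule has_integral_eq[of _ "\<lambda>t. ?n + 1"])
    show "?n + 1 = of_int \<lfloor>x + t\<rfloor>" if "t \<in> {?c..1}" for t
    proof -
      have "\<lfloor>x + t\<rfloor> = \<lfloor>x\<rfloor> + 1"
        using that c by (intro floor_unique) (auto simp: frac_def)
      then show ?thesis by simp
    qed
    show "((\<lambda>t. ?n + 1) has_integral frac x * (?n + 1)) {?c..1}"
      using has_integral_const_real[of "?n + 1" ?c 1] c by simp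
  qed
  ultimately have "((\<lambda>t. of_int \<lfloor>x + t\<rfloor>) has_integral ?c * ?n + frac x * (?n + 1)) {0..1}"
    using c by (intro has_integral_combine[of 0 ?c 1])
  moreover have "?c * ?n + frac x * (?n + 1) = x"
    by (simp add: frac_def algebra_simps)
  ultimately show ?thesis by simp
qed

lemma floor_diff_0_1:
  fixes x y :: real
  assumes "x \<le> y" "y \<le> x + 1"
  shows "real_of_int \<lfloor>y\<rfloor> - of_int \<lfloor>x\<rfloor> \<in> {0, 1}"
proof -
  have "\<lfloor>x\<rfloor> \<le> \<lfloor>y\<rfloor>" "\<lfloor>y\<rfloor> \<le> \<lfloor>x + 1\<rfloor>"
    using assms by (intro floor_mono; simp)+
  then have "\<lfloor>y\<rfloor> = \<lfloor>x\<rfloor> \<or> \<lfloor>y\<rfloor> = \<lfloor>x\<rfloor> + 1" by auto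
  then show ?thesis by auto
qed

lemma sum_telescope_downset:
  fixes G :: "'a::linorder set \<Rightarrow> 'b::ab_group_add"
  assumes "finite A" "\<And>x y. x \<in> A \<Longrightarrow> y \<le> x \<Longrightarrow> y \<in> A"
  shows "(\<Sum>i\<in>A. G {..i} - G {..<i}) = G A - G {}"
  using assms
proof (induction A rule: finite_linorder_max_induct)
  case empty
  then show ?case by simp
next
  case (insert b A)
  \<comment> \<open>Closure under smaller elements leaves no gaps below the maximum
    \<open>b\<close>, so the last summand is \<open>G {..b} - G A\<close> and cancels against the
    induction hypothesis.\<close>
  have A: "A = {..<b}"
    using insert.hyps insert.prems[of b] by (fastforce simp: less_le)
  then have b: "insert b A = {..b}" "b \<notin> A" by auto
  have "(\<Sum>i\<in>insert b A. G {..i} - G {..<i}) = G {..b} - G A + (\<Sum>i\<in>A. G {..i} - G {..<i})"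
    using insert.hyps(1) b(2) by (simp flip: A)
  also have "(\<Sum>i\<in>A. G {..i} - G {..<i}) = G A - G {}"
    using A by (intro insert.IH) auto
  finally show ?case
    by (simp add: b(1))
qed

lemma sum_telescope_atMost:
  fixes G :: "'a::{finite,linorder} set \<Rightarrow> 'b::ab_group_add"
  shows "(\<Sum>i\<in>{..k}. G {..i} - G {..<i}) = G {..k} - G {}"
  by (rule sum_telescope_downset) auto

lemma lessThan_eq_atMost:
  fixes i :: "'a::{finite,linorder}"
  assumes "{..<i} \<noteq> {}"
  obtains k where "{..<i} = {..k}"
proof
  have "Max {..<i} \<in> {..<i}" using assms by (intro Max_in) auto
  then show "{..<i} = {..Max {..<i}}" by (auto intro: Max_ge)
qed

lemma atMost_eq_insert_lessThan: "{..i} = insert i {..<i :: 'a::order}"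
  by auto

lemma finite_vec_components:
  assumes "finite A"
  shows "finite {v :: 'a ^ 'n. \<forall>i. v $ i \<in> A}"
proof (rule finite_subset)
  show "{v :: 'a ^ 'n. \<forall>i. v $ i \<in> A} \<subseteq> vec_lambda ` (UNIV \<rightarrow>\<^sub>E A)"
  proof
    fix v :: "'a ^ 'n" assume "v \<in> {v. \<forall>i. v $ i \<in> A}"
    then have "vec_nth v \<in> UNIV \<rightarrow>\<^sub>E A" by auto
    then show "v \<in> vec_lambda ` (UNIV \<rightarrow>\<^sub>E A)"
      by (intro image_eqI[of _ _ "vec_nth v"]) simp_all
  qed
  show "finite (vec_lambda ` (UNIV \<rightarrow>\<^sub>E A) :: ('a ^ 'n) set)"
    using assms by (intro finite_imageI finite_PiE) auto
qed

text \<open>Finiteness makes the convex hull compact, hence closed, as strict separation of a point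
  requires.\<close>

lemma finite_sign_matrices:
  "finite {M :: real ^ ('n::{finite,linorder}) ^ ('m::{finite,linorder}). sign_matrix M}"
proof (rule finite_subset)
  show "{M. sign_matrix M} \<subseteq> {M. \<forall>i. M $ i \<in> {v. \<forall>j. v $ j \<in> {-1, 0, 1}}}"
    by (auto simp: sign_matrix_def)
qed (intro finite_vec_components, simp)

lemma col_partial_sum_combine:
  "col_partial_sum (u *\<^sub>R X + v *\<^sub>R Y) i j = u * col_partial_sum X i j + v * col_partial_sum Y i j"
  by (simp add: col_partial_sum_def sum.distrib sum_distrib_left)

lemma row_partial_sum_combine:
  "row_partial_sum (u *\<^sub>R X + v *\<^sub>R Y) i j = u * row_partial_sum X i j + v * row_partial_sum Y i j"
  by (simp add: row_partial_sum_def sum.distrib sum_distrib_left)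

definition block_sum ::
    "real ^ ('n :: finite) ^ ('m :: finite) \<Rightarrow> 'm set \<Rightarrow> 'n set \<Rightarrow> real" where
  "block_sum X U V = (\<Sum>i\<in>U. \<Sum>j\<in>V. X $ i $ j)"

text \<open>Using \<open>{..<i}\<close> next to \<open>{..i}\<close> avoids naming the predecessor of an index, which the first
  index does not have.\<close>

definition rounded_matrix ::
    "real ^ ('n :: {finite, linorder}) ^ ('m :: {finite, linorder}) \<Rightarrow> real \<Rightarrow>
      real ^ ('n :: {finite, linorder}) ^ ('m :: {finite, linorder})" where
  "rounded_matrix X t = (\<chi> i j.
     (of_int \<lfloor>block_sum X {..i} {..j} + t\<rfloor> - of_int \<lfloor>block_sum X {..<i} {..j} + t\<rfloor>)
     - (of_int \<lfloor>block_sum X {..i} {..<j} + t\<rfloor> - of_int \<lfloor>block_sum X {..<i} {..<j} + t\<rfloor>))"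

lemma block_sum_empty [simp]: "block_sum X {} V = 0" "block_sum X U {} = 0"
  by (simp_all add: block_sum_def)

lemma block_sum_col:
  fixes X :: "real ^ ('n :: {finite, linorder}) ^ ('m :: {finite, linorder})"
  shows "block_sum X {..i} {..j} = block_sum X {..i} {..<j} + col_partial_sum X i j"
  by (simp add: block_sum_def col_partial_sum_def atMost_eq_insert_lessThan[of j] sum.distrib)

lemma block_sum_row:
  fixes X :: "real ^ ('n :: {finite, linorder}) ^ ('m :: {finite, linorder})"
  shows "block_sum X {..i} {..j} = block_sum X {..<i} {..j} + row_partial_sum X i j"
  by (simp add: block_sum_def row_partial_sum_def atMost_eq_insert_lessThan[of i])

text \<open>The entries are mixed second differences of rounded corner sums, so summing along a row
  telescopes in the column index. The boundary term \<open>G {}\<close> is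
  \<open>\<lfloor>t\<rfloor> - \<lfloor>t\<rfloor> = 0\<close>.\<close>

lemma row_partial_sum_rounded_matrix:
  "row_partial_sum (rounded_matrix X t) i j =
     of_int \<lfloor>block_sum X {..i} {..j} + t\<rfloor> - of_int \<lfloor>block_sum X {..<i} {..j} + t\<rfloor>"
  using sum_telescope_atMost[where k = j and
      G = "\<lambda>V. real_of_int \<lfloor>block_sum X {..i} V + t\<rfloor> - of_int \<lfloor>block_sum X {..<i} V + t\<rfloor>"]
  by (simp add: row_partial_sum_def rounded_matrix_def)

lemma col_partial_sum_rounded_matrix:
  "col_partial_sum (rounded_matrix X t) i j =
     of_int \<lfloor>block_sum X {..i} {..j} + t\<rfloor> - of_int \<lfloor>block_sum X {..i} {..<j} + t\<rfloor>"
  using sum_telescope_atMost[where k = i and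
      G = "\<lambda>U. real_of_int \<lfloor>block_sum X U {..j} + t\<rfloor> - of_int \<lfloor>block_sum X U {..<j} + t\<rfloor>"]
  by (simp add: col_partial_sum_def rounded_matrix_def algebra_simps)

lemma sign_matrix_rounded_matrix:
  fixes X :: "real ^ ('n :: {finite, linorder}) ^ ('m :: {finite, linorder})"
  assumes col: "\<And>i j. 0 \<le> col_partial_sum X i j \<and> col_partial_sum X i j \<le> 1"
    and row: "\<And>i j. 0 \<le> row_partial_sum X i j"
  shows "sign_matrix (rounded_matrix X t)"
proof -
  let ?F = "\<lambda>U V. real_of_int \<lfloor>block_sum X U V + t\<rfloor>"
  have C: "?F {..i} {..j} - ?F {..i} {..<j} \<in> {0, 1}" for i j
    using col[of i j] by (intro floor_diff_0_1) (auto simp: block_sum_col)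
  \<comment> \<open>This is \<open>C\<close> for the preceding row. Above the first row both terms
    are \<open>\<lfloor>t\<rfloor>\<close>. An entry is then a difference of two numbers in
    \<open>{0, 1}\<close>.\<close>
  have C': "?F {..<i} {..j} - ?F {..<i} {..<j} \<in> {0, 1}" for i j
  proof (cases "{..<i} = {}")
    case True
    then show ?thesis by simp
  next
    case False
    then obtain k where "{..<i} = {..k}" by (rule lessThan_eq_atMost)
    then show ?thesis using C[of k j] by simp
  qed
  have R: "0 \<le> ?F {..i} {..j} - ?F {..<i} {..j}" for i j
    using row[of i j] by (simp add: block_sum_row floor_mono)
  have "rounded_matrix X t $ i $ j \<in> {-1, 0, 1}" for i j
  proof -
    have "rounded_matrix X t $ i $ j =
        (?F {..i} {..j} - ?F {..i} {..<j}) - (?F {..<i} {..j} - ?F {..<i} {..<j})"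
      by (simp add: rounded_matrix_def)
    then show ?thesis using C[of i j] C'[of i j] by auto
  qed
  then show ?thesis
    unfolding sign_matrix_def row_partial_sum_rounded_matrix col_partial_sum_rounded_matrix
    using C R by blast
qed

text \<open>Integrating each of the four floors removes the rounding, and the mixed second
  difference of the exact corner sums is the entry of \<open>X\<close>.\<close>

lemma has_integral_rounded_matrix:
  "((\<lambda>t. rounded_matrix X t $ i $ j) has_integral X $ i $ j) {0..1}"
proof -
  have "((\<lambda>t. rounded_matrix X t $ i $ j) has_integral
      (block_sum X {..i} {..j} - block_sum X {..<i} {..j})
      - (block_sum X {..i} {..<j} - block_sum X {..<i} {..<j})) {0..1}"
    unfolding rounded_matrix_def
    by (simp, intro has_integral_diff has_integral_floor_add)
  moreover have "(block_sum X {..i} {..j} - block_sum X {..<i} {..j})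
      - (block_sum X {..i} {..<j} - block_sum X {..<i} {..<j}) = X $ i $ j"
    by (simp add: block_sum_def atMost_eq_insert_lessThan)
  ultimately show ?thesis by simp
qed

lemma has_integral_inner_rounded_matrix:
  "((\<lambda>t. a \<bullet> rounded_matrix X t) has_integral a \<bullet> X) {0..1}"
  unfolding inner_vec_def inner_real_def
  by (intro has_integral_sum has_integral_mult_right has_integral_rounded_matrix) auto

theorem theorem5p3:
  "(sign_matrix_polytope :: (real ^ ('n :: {finite, linorder}) ^ ('m :: {finite, linorder})) set) =
     {X. (\<forall>i j. 0 \<le> col_partial_sum X i j \<and> col_partial_sum X i j \<le> 1) \<and>
         (\<forall>i j. 0 \<le> row_partial_sum X i j)}"
    (is "_ = ?Q")
proof
  have "convex ?Q"
    by (auto simp: convex_def col_partial_sum_combine row_partial_sum_combine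
        intro!: convex_bound_le)
  moreover have "{M. sign_matrix M} \<subseteq> ?Q"
  proof
    fix M :: "((real, 'n) vec, 'm) vec" assume "M \<in> {M. sign_matrix M}"
    then have C: "col_partial_sum M i j \<in> {0, 1}" and R: "0 \<le> row_partial_sum M i j" for i j
      by (auto simp: sign_matrix_def)
    have "0 \<le> col_partial_sum M i j \<and> col_partial_sum M i j \<le> 1" for i j
      using C[of i j] by auto
    with R show "M \<in> ?Q" by blast
  qed
  ultimately show "sign_matrix_polytope \<subseteq> ?Q"
    unfolding sign_matrix_polytope_def by (intro hull_minimal)
next
  show "?Q \<subseteq> sign_matrix_polytope"
  proof (rule subsetI, rule ccontr)
    fix X :: "((real, 'n) vec, 'm) vec"
    assume X: "X \<in> ?Q" "X \<notin> sign_matrix_polytope"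
    have "closed (sign_matrix_polytope :: ((real, 'n) vec, 'm) vec set)"
      unfolding sign_matrix_polytope_def
      by (intro compact_imp_closed finite_imp_compact_convex_hull finite_sign_matrices)
    moreover have "convex (sign_matrix_polytope :: ((real, 'n) vec, 'm) vec set)"
      by (simp add: sign_matrix_polytope_def)
    ultimately obtain a b where ab: "a \<bullet> X < b" "\<And>Y. Y \<in> sign_matrix_polytope \<Longrightarrow> b < a \<bullet> Y"
      using X(2) separating_hyperplane_closed_point by metis
    \<comment> \<open>The bound holds for every shift \<open>t\<close>, so it survives averaging
      over \<open>[0,1]\<close>, which turns the rounded matrices back into
      \<open>X\<close>.\<close>
    have "b \<le> a \<bullet> rounded_matrix X t" for t
    proof -
      have "sign_matrix (rounded_matrix X t)"
        using X(1) by (intro sign_matrix_rounded_matrix) auto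
      then have "rounded_matrix X t \<in> sign_matrix_polytope"
        unfolding sign_matrix_polytope_def by (intro hull_inc) simp
      then show ?thesis using ab(2) by (simp add: less_imp_le)
    qed
    moreover have "((\<lambda>t. b) has_integral b) {0..1::real}"
      using has_integral_const_real[of b 0 1] by simp
    ultimately have "b \<le> a \<bullet> X"
      using has_integral_le has_integral_inner_rounded_matrix by blast
    with ab(1) show False by simp
  qed
qed

end
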